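(* For any $a,b\in\mathcal{A}$, the weak solutions $u_a,u_b\in H^1_0(0,1)$ with right side $f=1$ satisfy $$\|a-b\|_{L_2(0,1)}\le C\|u_a-u_b\|_{H^1_0(0,1)}^{2/9},$$ where $C$ depends only on $\lambda$ and $\Lambda$. In particular, if $u_a=u_b$ on $(0,1)$, then $a=b$ a.e. in $(0,1)$.
   Context: Here the domain is $D=(0,1)$. $\lambda,\Lambda$ are fixed positive constants and $\mathcal{A}:=\{a\in L_\infty(0,1):\lambda\le a\le\Lambda\}$. $H^1_0(0,1)$ is equipped with the norm $\|v\|_{H^1_0(0,1)}=\|v'\|_{L_2(0,1)}$. For $a\in\mathcal{A}$, $u_a\in H^1_0(0,1)$ is the unique solution of $\int_0^1 au_a'v'=\int_0^1 v$ for all $v\in H^1_0(0,1)$. *)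

theory Defs
  imports "HOL-Analysis.Analysis"
begin

text \<open>
  Elements of \<open>L\<^sub>2\<close>, \<open>L\<^sub>\<infinity>\<close>, \<open>H\<^sup>1\<close> and \<open>H\<^sup>1\<^sub>0\<close> are represented by functions \<open>real \<Rightarrow> real\<close>, of which
  only the restriction to the open unit interval, up to null sets, is relevant.
\<close>

abbreviation U :: "real measure" where
  "U \<equiv> lebesgue_on {0<..<1}"

definition L2 :: "(real \<Rightarrow> real) set" where
  "L2 = {f \<in> borel_measurable U. integrable U (\<lambda>x. (f x)\<^sup>2)}"

definition L2_norm :: "(real \<Rightarrow> real) \<Rightarrow> real" where
  "L2_norm f = sqrt (\<integral>x. (f x)\<^sup>2 \<partial>U)"

definition L_infinity :: "(real \<Rightarrow> real) set" where
  "L_infinity = {f \<in> borel_measurable U. \<exists>M. AE x in U. \<bar>f x\<bar> \<le> M}"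

definition test_functions :: "(real \<Rightarrow> real) set" where
  "test_functions =
    {\<phi>. (\<forall>k x. (deriv ^^ k) \<phi> differentiable (at x)) \<and>
        compact (closure {x. \<phi> x \<noteq> 0}) \<and> closure {x. \<phi> x \<noteq> 0} \<subseteq> {0<..<1}}"

definition is_weak_derivative :: "(real \<Rightarrow> real) \<Rightarrow> (real \<Rightarrow> real) \<Rightarrow> bool" where
  "is_weak_derivative u g \<longleftrightarrow>
    (\<forall>\<phi>\<in>test_functions. (\<integral>x. u x * deriv \<phi> x \<partial>U) = - (\<integral>x. g x * \<phi> x \<partial>U))"

definition H1 :: "(real \<Rightarrow> real) set" where
  "H1 = {u \<in> L2. \<exists>g\<in>L2. is_weak_derivative u g}"

text \<open>
  For \<open>u \<in> H1\<close> the weak derivative is unique up to null sets, so the choice of representative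
  does not affect any integral below; for other \<open>u\<close> the value is unspecified.
\<close>

definition weak_deriv :: "(real \<Rightarrow> real) \<Rightarrow> real \<Rightarrow> real" where
  "weak_deriv u = (SOME g. g \<in> L2 \<and> is_weak_derivative u g)"

definition H1_norm :: "(real \<Rightarrow> real) \<Rightarrow> real" where
  "H1_norm u = sqrt ((L2_norm u)\<^sup>2 + (L2_norm (weak_deriv u))\<^sup>2)"

definition H10 :: "(real \<Rightarrow> real) set" where
  "H10 = {u \<in> H1. \<exists>\<phi> :: nat \<Rightarrow> real \<Rightarrow> real.
            (\<forall>n. \<phi> n \<in> test_functions) \<and> (\<lambda>n. H1_norm (\<lambda>x. u x - \<phi> n x)) \<longlonglongrightarrow> 0}"

definition H10_norm :: "(real \<Rightarrow> real) \<Rightarrow> real" where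
  "H10_norm v = L2_norm (weak_deriv v)"

definition coefficients :: "real \<Rightarrow> real \<Rightarrow> (real \<Rightarrow> real) set" where
  "coefficients l L = {a \<in> L_infinity. AE x in U. l \<le> a x \<and> a x \<le> L}"

definition is_weak_solution ::
  "(real \<Rightarrow> real) \<Rightarrow> (real \<Rightarrow> real) \<Rightarrow> (real \<Rightarrow> real) \<Rightarrow> bool" where
  "is_weak_solution a f u \<longleftrightarrow>
    u \<in> H10 \<and>
    (\<forall>v\<in>H10. (\<integral>x. a x * weak_deriv u x * weak_deriv v x \<partial>U) = (\<integral>x. f x * v x \<partial>U))"

end

theory Submission
  imports Defs
begin

text \<open>
  The flux of a weak solution with right side \<open>1\<close> is explicit: \<open>a u\<^sub>a' = \<alpha> - x\<close> for a constant \<open>\<alpha>\<close>, and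
  \<open>\<alpha> \<in> [0,1]\<close> because \<open>u\<^sub>a'\<close> has mean zero. Likewise \<open>b u\<^sub>b' = \<beta> - x\<close>. Put
  \<open>E = \<parallel>u\<^sub>a' - u\<^sub>b'\<parallel>\<close> and \<open>\<delta> = \<bar>\<alpha> - \<beta>\<bar>\<close>. Between \<open>\<alpha>\<close> and \<open>\<beta>\<close> the two derivatives have opposite signs
  and differ by at least \<open>\<delta> / L\<close>, so \<open>\<delta>\<^sup>3 \<le> L\<^sup>2 E\<^sup>2\<close>. Now
  \<open>(a - b) u\<^sub>a' = (\<alpha> - \<beta>) - b (u\<^sub>a' - u\<^sub>b')\<close> with \<open>\<bar>u\<^sub>a'\<bar> \<ge> \<bar>x - \<alpha>\<bar> / L\<close>. Using this identity where
  \<open>\<bar>x - \<alpha>\<bar> \<ge> r\<close> and the trivial bound \<open>\<bar>a - b\<bar> \<le> L\<close> elsewhere gives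
  \<open>\<parallel>a - b\<parallel>\<^sup>2 \<lesssim> r + (\<delta>\<^sup>2 + E\<^sup>2) / r\<^sup>2\<close>; the choice \<open>r = E\<^bsup>4/9\<^esup>\<close> yields the exponent \<open>2/9\<close>.
\<close>

subsection \<open>Smooth functions\<close>

text \<open>The regularity half of \<open>test_functions\<close>, split off so that factors without
  compact support can be handled as well.\<close>

definition smooth :: "(real \<Rightarrow> real) \<Rightarrow> bool" where
  "smooth f \<longleftrightarrow> (\<forall>k x. (deriv ^^ k) f differentiable (at x))"

text \<open>A set of differentiable functions that is closed under \<open>deriv\<close> contains all
  iterated derivatives of its members. Smoothness of a concrete function thus reduces to finding
  such a set, with no formula for its k-th derivative.\<close>

lemma smooth_coinduct:
  assumes "f \<in> S" and "\<And>g x. g \<in> S \<Longrightarrow> g differentiable (at x)"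
    and "\<And>g. g \<in> S \<Longrightarrow> deriv g \<in> S"
  shows "smooth f"
proof -
  have "(deriv ^^ k) f \<in> S" for k
    by (induction k) (use assms in auto)
  then show ?thesis
    unfolding smooth_def using assms(2) by blast
qed

lemma smooth_deriv: "smooth f \<Longrightarrow> smooth (deriv f)"
  unfolding smooth_def by (metis funpow_simps_right(2) comp_apply)

lemma smooth_DERIV: "smooth f \<Longrightarrow> (f has_real_derivative deriv f x) (at x)"
  unfolding smooth_def using DERIV_deriv_iff_real_differentiable by (metis funpow_0)

lemma smooth_differentiable: "smooth f \<Longrightarrow> f differentiable (at x)"
  using smooth_DERIV real_differentiable_def by blast

lemma smooth_continuous_on: "smooth f \<Longrightarrow> continuous_on A f"
  using smooth_DERIV DERIV_isCont continuous_at_imp_continuous_on by blast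

lemma smooth_antiderivative:
  assumes F: "\<And>x. (F has_real_derivative f x) (at x)" and f: "smooth f"
  shows "smooth F"
proof (rule smooth_coinduct[where S = "insert F {g. smooth g}"])
  have "deriv F = f"
    using F DERIV_imp_deriv by blast
  with f show "deriv g \<in> insert F {g. smooth g}" if "g \<in> insert F {g. smooth g}" for g
    using that smooth_deriv by auto
  show "g differentiable (at x)" if "g \<in> insert F {g. smooth g}" for g x
    using that F smooth_differentiable real_differentiable_def by blast
qed simp

lemma smooth_affine:
  assumes "smooth f"
  shows "smooth (\<lambda>x. f (m * x + c))"
\<comment> \<open>The scalar A absorbs the factor m that the chain rule produces at each
  differentiation.\<close>
proof (rule smooth_coinduct[where S = "{\<lambda>x. A * g (m * x + c) |A g. smooth g}"])
  have "\<exists>A. (\<lambda>x. f (m * x + c)) = (\<lambda>x. A * f (m * x + c))"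
    by (rule exI[of _ 1]) auto
  then show "(\<lambda>x. f (m * x + c)) \<in> {\<lambda>x. A * g (m * x + c) |A g. smooth g}"
    using assms by blast
  have D: "((\<lambda>x. A * g (m * x + c)) has_real_derivative (A * m) * deriv g (m * x + c)) (at x)"
    if "smooth g" for A g x
    by (auto intro!: derivative_eq_intros DERIV_chain2[OF smooth_DERIV[OF that]])
  then show "h differentiable (at x)" if "h \<in> {\<lambda>x. A * g (m * x + c) |A g. smooth g}" for h x
    using that real_differentiable_def by blast
  show "deriv h \<in> {\<lambda>x. A * g (m * x + c) |A g. smooth g}"
    if h: "h \<in> {\<lambda>x. A * g (m * x + c) |A g. smooth g}" for h
  proof -
    obtain A g where g: "h = (\<lambda>x. A * g (m * x + c))" "smooth g"
      using h by blast
    then have "deriv h = (\<lambda>x. (A * m) * deriv g (m * x + c))"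
      using D DERIV_imp_deriv by blast
    then show ?thesis
      using g smooth_deriv by blast
  qed
qed

text \<open>
  Closing the smooth functions under sums and products gives a set that is stable under \<^const>\<open>deriv\<close>, so
  \<open>smooth_coinduct\<close> applies to it without a Leibniz formula for higher derivatives.
\<close>

inductive_set smooth_algebra :: "(real \<Rightarrow> real) set" where
  "smooth f \<Longrightarrow> f \<in> smooth_algebra"
| "f \<in> smooth_algebra \<Longrightarrow> g \<in> smooth_algebra \<Longrightarrow> (\<lambda>x. f x + g x) \<in> smooth_algebra"
| "f \<in> smooth_algebra \<Longrightarrow> g \<in> smooth_algebra \<Longrightarrow> (\<lambda>x. f x * g x) \<in> smooth_algebra"

lemma smooth_algebra_smooth:
  assumes "f \<in> smooth_algebra"
  shows "smooth f"
proof -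
  \<comment> \<open>Both claims go through one induction: the product rule needs the derivatives of
    the factors to exist and to lie in the algebra again.\<close>
  have *: "(\<forall>x. (f has_real_derivative deriv f x) (at x)) \<and> deriv f \<in> smooth_algebra"
    if "f \<in> smooth_algebra" for f
    using that
  proof induction
    case (1 f)
    then show ?case
      using smooth_DERIV smooth_deriv smooth_algebra.intros(1) by blast
  next
    case (2 f g)
    have D: "((\<lambda>x. f x + g x) has_real_derivative deriv f x + deriv g x) (at x)" for x
      using 2 by (intro DERIV_add) auto
    then have "deriv (\<lambda>x. f x + g x) = (\<lambda>x. deriv f x + deriv g x)"
      using DERIV_imp_deriv by blast
    then show ?case
      using D 2 smooth_algebra.intros(2) by auto
  next
    case (3 f g)
    have D: "((\<lambda>x. f x * g x) has_real_derivative deriv f x * g x + f x * deriv g x) (at x)" for x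
      using 3 by (auto intro!: derivative_eq_intros)
    then have "deriv (\<lambda>x. f x * g x) = (\<lambda>x. deriv f x * g x + f x * deriv g x)"
      using DERIV_imp_deriv by blast
    then show ?case
      using D 3 by (auto intro!: smooth_algebra.intros(2,3))
  qed
  show ?thesis
    by (rule smooth_coinduct[OF assms]) (use * real_differentiable_def in blast)+
qed

lemma smooth_add: "smooth f \<Longrightarrow> smooth g \<Longrightarrow> smooth (\<lambda>x. f x + g x)"
  and smooth_mult: "smooth f \<Longrightarrow> smooth g \<Longrightarrow> smooth (\<lambda>x. f x * g x)"
  by (auto intro!: smooth_algebra_smooth smooth_algebra.intros(2,3) intro: smooth_algebra.intros(1))

lemma smooth_const: "smooth (\<lambda>x. c)"
  by (rule smooth_coinduct[where S = "range (\<lambda>c x. c)"]) (auto simp: fun_eq_iff)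

text \<open>The classical smooth function that is flat at the origin. Products of two affine copies
  of it serve below as bump functions.\<close>

definition flat_exp :: "real \<Rightarrow> real" where
  "flat_exp x = (if x > 0 then exp (- (1 / x)) else 0)"

text \<open>The polynomial in 1/x is there because all derivatives of \<open>flat_exp\<close> have
  this shape. From the right, y = 1/x turns the claim into exponential growth beating polynomial
  growth; from the left the function is zero.\<close>

lemma poly_inverse_times_flat_exp_tendsto_0:
  "((\<lambda>x. poly p (1 / x) * flat_exp x) \<longlongrightarrow> 0) (at (0::real))"
proof -
  have "((\<lambda>x. poly p (1 / x) * flat_exp x) \<longlongrightarrow> 0) (at_right 0)"
  proof -
    have "((\<lambda>y. poly p y / exp y) \<longlongrightarrow> 0) at_top"
    proof -
      have "((\<lambda>y. \<Sum>i\<le>degree p. coeff p i * (y ^ i / exp y)) \<longlongrightarrow> (\<Sum>i\<le>degree p. coeff p i * 0)) at_top"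
        by (intro tendsto_intros tendsto_power_div_exp_0)
      then show ?thesis
        by (simp add: poly_altdef sum_divide_distrib)
    qed
    then have "((\<lambda>x. poly p (inverse x) / exp (inverse x)) \<longlongrightarrow> 0) (at_right 0)"
      by (rule filterlim_compose[OF _ filterlim_inverse_at_top_right])
    then show ?thesis
      by (rule Lim_transform_eventually)
        (auto simp: eventually_at_right_field flat_exp_def exp_minus field_simps intro!: exI[of _ 1])
  qed
  moreover have "((\<lambda>x. poly p (1 / x) * flat_exp x) \<longlongrightarrow> 0) (at_left 0)"
    by (rule Lim_transform_eventually[OF tendsto_const])
      (auto simp: eventually_at_left_field flat_exp_def intro!: exI[of _ "-1"])
  ultimately show ?thesis
    by (simp add: filterlim_split_at)
qed

lemma smooth_flat_exp: "smooth flat_exp"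
proof (rule smooth_coinduct[where S = "range (\<lambda>p x. poly p (1 / x) * flat_exp x)"])
  have "flat_exp = (\<lambda>x. poly 1 (1 / x) * flat_exp x)"
    by auto
  then show "flat_exp \<in> range (\<lambda>p x. poly p (1 / x) * flat_exp x)"
    by (rule range_eqI)
  \<comment> \<open>Differentiating p(1/x) exp(-1/x) gives (p - p')(1/x) / x^2 times the
    exponential; \<open>monom 1 2\<close> is the factor 1/x^2. At the origin both sides are covered
    by the same formula, since \<open>flat_exp 0 = 0\<close> makes its value 0.\<close>
  have D: "((\<lambda>x. poly p (1 / x) * flat_exp x) has_real_derivative
      poly ((p - pderiv p) * monom 1 2) (1 / x) * flat_exp x) (at x)" for p x
  proof -
    consider "x > 0" | "x < 0" | "x = 0"
      by linarith
    then show ?thesis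
    proof cases
      case 1
      have "((\<lambda>x. poly p (1 / x) * exp (- (1 / x))) has_real_derivative
          poly ((p - pderiv p) * monom 1 2) (1 / x) * flat_exp x) (at x)"
        using 1
        by (auto intro!: derivative_eq_intros DERIV_chain2[OF poly_DERIV]
            simp: flat_exp_def poly_monom field_simps power2_eq_square)
      then show ?thesis
        by (rule DERIV_cong_ev[OF refl _ refl, THEN iffD1, rotated])
          (use 1 eventually_nhds_in_open[of "{0<..}" x] in \<open>auto elim!: eventually_mono simp: flat_exp_def\<close>)
    next
      case 2
      then have "((\<lambda>x. 0) has_real_derivative
          poly ((p - pderiv p) * monom 1 2) (1 / x) * flat_exp x) (at x)"
        by (simp add: flat_exp_def)
      then show ?thesis
        by (rule DERIV_cong_ev[OF refl _ refl, THEN iffD1, rotated])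
          (use 2 eventually_nhds_in_open[of "{..<0}" x] in \<open>auto elim!: eventually_mono simp: flat_exp_def\<close>)
    next
      case 3
      \<comment> \<open>This is the difference quotient at 0: its division by y becomes one more
        factor 1/y, that is, \<open>[:0, 1:]\<close>.\<close>
      have "((\<lambda>y. poly (p * [:0, 1:]) (1 / y) * flat_exp y) \<longlongrightarrow> 0) (at 0)"
        by (rule poly_inverse_times_flat_exp_tendsto_0)
      then show ?thesis
        using 3 by (simp add: has_field_derivative_iff flat_exp_def mult_ac)
    qed
  qed
  show "g differentiable (at x)" if "g \<in> range (\<lambda>p x. poly p (1 / x) * flat_exp x)" for g x
    using that D real_differentiable_def by blast
  show "deriv g \<in> range (\<lambda>p x. poly p (1 / x) * flat_exp x)"
    if g: "g \<in> range (\<lambda>p x. poly p (1 / x) * flat_exp x)" for g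
  proof -
    obtain p where "g = (\<lambda>x. poly p (1 / x) * flat_exp x)"
      using g by blast
    then have "deriv g = (\<lambda>x. poly ((p - pderiv p) * monom 1 2) (1 / x) * flat_exp x)"
      using D DERIV_imp_deriv by blast
    then show ?thesis
      by blast
  qed
qed

subsection \<open>Test functions\<close>

text \<open>The working form of the support condition: an enclosing closed interval is easier to
  carry through sums, products and derivatives than the closure of a set.\<close>

lemma test_functions_iff:
  "\<phi> \<in> test_functions \<longleftrightarrow>
    smooth \<phi> \<and> (\<exists>p q. 0 < p \<and> p \<le> q \<and> q < 1 \<and> (\<forall>x. x \<notin> {p..q} \<longrightarrow> \<phi> x = 0))" (is "_ \<longleftrightarrow> ?R")
proof
  assume \<phi>: "\<phi> \<in> test_functions"
  \<comment> \<open>The point 1/2 keeps the compact set nonempty when \<phi> is zero, so that its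
    minimum and maximum exist.\<close>
  define K where "K = insert (1/2) (closure {x. \<phi> x \<noteq> 0})"
  have K: "compact K" "K \<noteq> {}" "K \<subseteq> {0<..<1}"
    using \<phi> by (auto simp: K_def test_functions_def)
  obtain p where p: "p \<in> K" "\<forall>x\<in>K. p \<le> x"
    using compact_attains_inf[OF K(1,2)] by blast
  obtain q where q: "q \<in> K" "\<forall>x\<in>K. x \<le> q"
    using compact_attains_sup[OF K(1,2)] by blast
  have "\<phi> x = 0" if "x \<notin> {p..q}" for x
  proof (rule ccontr)
    assume "\<phi> x \<noteq> 0"
    then have "x \<in> K"
      using closure_subset[of "{x. \<phi> x \<noteq> 0}"] unfolding K_def by blast
    then show False
      using p q that by auto
  qed
  moreover have "smooth \<phi>"
    using \<phi> by (simp add: test_functions_def smooth_def)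
  moreover have "0 < p" "p \<le> q" "q < 1"
    using p q K(3) by auto
  ultimately show ?R
    by blast
next
  assume ?R
  then obtain p q where *: "smooth \<phi>" "0 < p" "q < 1" "\<And>x. x \<notin> {p..q} \<Longrightarrow> \<phi> x = 0"
    by blast
  have "closure {x. \<phi> x \<noteq> 0} \<subseteq> {p..q}"
    using *(4) by (intro closure_minimal subsetI) (metis mem_Collect_eq, rule closed_atLeastAtMost)
  moreover from this have "compact (closure {x. \<phi> x \<noteq> 0})"
    using compact_Int_closed[OF compact_Icc closed_closure] by (metis inf.absorb2)
  ultimately show "\<phi> \<in> test_functions"
    using * by (auto simp: test_functions_def smooth_def)
qed

lemma test_functionsE:
  assumes "\<phi> \<in> test_functions"
  obtains p q where "smooth \<phi>" "0 < p" "p \<le> q" "q < 1" "\<And>x. x \<notin> {p..q} \<Longrightarrow> \<phi> x = 0"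
  using assms unfolding test_functions_iff by blast

lemma test_functions_smooth: "\<phi> \<in> test_functions \<Longrightarrow> smooth \<phi>"
  by (simp add: test_functions_iff)

lemma test_functions_deriv:
  assumes "\<phi> \<in> test_functions"
  shows "deriv \<phi> \<in> test_functions"
proof -
  from assms obtain p q where *: "smooth \<phi>" "0 < p" "p \<le> q" "q < 1" "\<And>x. x \<notin> {p..q} \<Longrightarrow> \<phi> x = 0"
    by (rule test_functionsE) blast
  have "deriv \<phi> x = 0" if x: "x \<notin> {p..q}" for x
  proof (rule DERIV_imp_deriv)
    show "(\<phi> has_real_derivative 0) (at x)"
    proof (rule DERIV_cong_ev[OF refl _ refl, THEN iffD1])
      show "\<forall>\<^sub>F y in nhds x. 0 = \<phi> y"
        by (rule eventually_mono[OF eventually_nhds_in_open[of "- {p..q}"]]) (use x * in auto)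
      show "((\<lambda>y. 0) has_real_derivative 0) (at x)"
        by simp
    qed
  qed
  then show ?thesis
    unfolding test_functions_iff using * smooth_deriv by blast
qed

lemma test_functions_mult:
  assumes "\<phi> \<in> test_functions" "smooth f"
  shows "(\<lambda>x. f x * \<phi> x) \<in> test_functions"
proof -
  from assms(1) obtain p q where
    "smooth \<phi>" "0 < p" "p \<le> q" "q < 1" "\<And>x. x \<notin> {p..q} \<Longrightarrow> \<phi> x = 0"
    by (rule test_functionsE) blast
  then show ?thesis
    unfolding test_functions_iff using smooth_mult[OF assms(2)]
    by (intro conjI exI[of _ p] exI[of _ q]) auto
qed

lemma test_functions_add:
  assumes "\<phi> \<in> test_functions" "\<psi> \<in> test_functions"
  shows "(\<lambda>x. \<phi> x + \<psi> x) \<in> test_functions"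
proof -
  from assms(1) obtain p q where
    1: "smooth \<phi>" "0 < p" "p \<le> q" "q < 1" "\<And>x. x \<notin> {p..q} \<Longrightarrow> \<phi> x = 0"
    by (rule test_functionsE) blast
  from assms(2) obtain p' q' where
    2: "smooth \<psi>" "0 < p'" "p' \<le> q'" "q' < 1" "\<And>x. x \<notin> {p'..q'} \<Longrightarrow> \<psi> x = 0"
    by (rule test_functionsE) blast
  have "\<phi> x + \<psi> x = 0" if "x \<notin> {min p p'..max q q'}" for x
  proof -
    have "x \<notin> {p..q}" "x \<notin> {p'..q'}"
      using that by auto
    then show ?thesis
      using 1(5) 2(5) by simp
  qed
  then show ?thesis
    unfolding test_functions_iff using smooth_add[OF 1(1) 2(1)] 1(2-4) 2(2-4)
    by (intro conjI exI[of _ "min p p'"] exI[of _ "max q q'"]) auto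
qed

lemma test_functions_bounded:
  assumes "\<phi> \<in> test_functions"
  obtains M where "\<And>x. \<bar>\<phi> x\<bar> \<le> M"
proof -
  from assms obtain p q where *: "smooth \<phi>" "p \<le> q" "\<And>x. x \<notin> {p..q} \<Longrightarrow> \<phi> x = 0"
    by (rule test_functionsE) blast
  have "bounded (\<phi> ` {p..q})"
    by (intro compact_imp_bounded compact_continuous_image smooth_continuous_on *) auto
  then obtain M where M: "\<And>x. x \<in> {p..q} \<Longrightarrow> \<bar>\<phi> x\<bar> \<le> M"
    unfolding bounded_iff by (metis imageI real_norm_def)
  have "\<bar>\<phi> x\<bar> \<le> M" for x
    using M[of x] M[of p] * by (cases "x \<in> {p..q}") auto
  then show ?thesis
    using that by blast
qed

section \<open>Integration on the unit interval\<close>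

lemma continuous_measurable_U: "continuous_on UNIV f \<Longrightarrow> f \<in> borel_measurable U"
  for f :: "real \<Rightarrow> real"
  by (intro measurable_restrict_space1 measurable_completion) (simp add: borel_measurable_continuous_onI)

lemma test_functions_measurable: "\<phi> \<in> test_functions \<Longrightarrow> \<phi> \<in> borel_measurable U"
  by (intro continuous_measurable_U smooth_continuous_on test_functions_smooth)

interpretation U: finite_measure U
  by (rule finite_measure_lebesgue_on) simp

lemma measure_U: "0 \<le> a \<Longrightarrow> a \<le> b \<Longrightarrow> b \<le> 1 \<Longrightarrow> measure U {a<..<b} = b - a"
  by (subst measure_restrict_space) auto

lemma integrable_mult_bounded:
  fixes f g :: "'a \<Rightarrow> real"
  assumes "integrable M f" "g \<in> borel_measurable M" "AE x in M. \<bar>g x\<bar> \<le> B"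
  shows "integrable M (\<lambda>x. f x * g x)"
proof (rule Bochner_Integration.integrable_bound[where f = "\<lambda>x. B * f x"])
  show "AE x in M. norm (f x * g x) \<le> norm (B * f x)"
    using assms(3)
  proof eventually_elim
    case (elim x)
    then have "\<bar>f x\<bar> * \<bar>g x\<bar> \<le> \<bar>f x\<bar> * \<bar>B\<bar>"
      by (intro mult_left_mono) auto
    then show ?case
      by (simp add: abs_mult mult.commute)
  qed
qed (use assms in auto)

lemma integrable_mult_test_function:
  assumes "integrable U f" "\<phi> \<in> test_functions"
  shows "integrable U (\<lambda>x. f x * \<phi> x)"
proof -
  obtain M where "\<And>x. \<bar>\<phi> x\<bar> \<le> M"
    using test_functions_bounded[OF assms(2)] by blast
  then show ?thesis
    by (intro integrable_mult_bounded[where B = M] test_functions_measurable AE_I2 assms)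
qed

lemma integrable_test_function: "\<phi> \<in> test_functions \<Longrightarrow> integrable U \<phi>"
  using integrable_mult_test_function[of "\<lambda>_. 1" \<phi>] by simp

text \<open>The fundamental theorem of calculus yields a gauge integral over the closed interval.
  Integrability of f identifies it with the Lebesgue integral over the open one.\<close>

lemma integral_deriv_U:
  assumes D: "\<And>x. (F has_real_derivative f x) (at x)" and f: "integrable U f"
  shows "(\<integral>x. f x \<partial>U) = F 1 - F 0"
proof -
  have "(f has_integral (F 1 - F 0)) {0..1}"
    by (rule fundamental_theorem_of_calculus)
      (use D in \<open>auto simp: has_real_derivative_iff_has_vector_derivative has_vector_derivative_at_within\<close>)
  then have "integral {0<..<1} f = F 1 - F 0"
    using integral_open_interval_real integral_unique by metis
  then show ?thesis
    by (simp add: lebesgue_integral_eq_integral[OF f])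
qed

lemma integral_deriv_test_function:
  assumes "\<phi> \<in> test_functions"
  shows "(\<integral>x. deriv \<phi> x \<partial>U) = 0"
proof -
  have "\<phi> 0 = 0" "\<phi> 1 = 0"
    using assms by (auto elim!: test_functionsE)
  then show ?thesis
    using integral_deriv_U[OF smooth_DERIV[OF test_functions_smooth[OF assms]]]
      integrable_test_function[OF test_functions_deriv[OF assms]] by simp
qed

lemma integral_by_parts_test_function:
  assumes "\<phi> \<in> test_functions" "smooth f"
  shows "(\<integral>x. f x * deriv \<phi> x \<partial>U) = - (\<integral>x. deriv f x * \<phi> x \<partial>U)"
proof -
  have "deriv (\<lambda>x. f x * \<phi> x) = (\<lambda>x. f x * deriv \<phi> x + deriv f x * \<phi> x)"
    by (rule ext, rule DERIV_imp_deriv)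
      (use assms in \<open>auto intro!: derivative_eq_intros smooth_DERIV dest: test_functions_smooth\<close>)
  then have "(\<integral>x. f x * deriv \<phi> x + deriv f x * \<phi> x \<partial>U) = 0"
    using integral_deriv_test_function[OF test_functions_mult[OF assms]] by simp
  moreover have "integrable U (\<lambda>x. f x * deriv \<phi> x)" "integrable U (\<lambda>x. deriv f x * \<phi> x)"
    using assms by (auto intro!: integrable_test_function test_functions_mult test_functions_deriv smooth_deriv)
  ultimately show ?thesis
    by simp
qed

section \<open>The fundamental lemma of the calculus of variations\<close>

text \<open>The open left rays are an intersection-stable generator of the Borel sets, so a Dynkin
  argument carries the vanishing of the integral from rays to Borel sets. Lebesgue sets differ from
  Borel sets by null sets.\<close>

lemma AE_zero_if_integral_Iio_zero:
  fixes g :: "real \<Rightarrow> real"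
  assumes g: "integrable U g"
    and zero: "\<And>q. 0 < q \<Longrightarrow> q \<le> 1 \<Longrightarrow> (\<integral>x. indicator {..<q} x * g x \<partial>U) = 0"
  shows "AE x in U. g x = 0"
proof (rule U.density_zero[OF g])
  have [measurable]: "g \<in> borel_measurable U"
    using g by auto
  have borel_U: "B \<inter> {0<..<1} \<in> sets U" if "B \<in> sets borel" for B :: "real set"
    using that by (auto simp: sets_restrict_space_iff)
  have int: "integrable U (\<lambda>x. indicator B x * g x)" if "B \<in> sets borel" for B :: "real set"
  proof -
    have "integrable U (\<lambda>x. indicator (B \<inter> {0<..<1}) x *\<^sub>R g x)"
      by (rule integrable_mult_indicator[OF borel_U[OF that] g])
    then show ?thesis
      by (rule Bochner_Integration.integrable_cong[OF refl, THEN iffD1, rotated]) (auto simp: indicator_def)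
  qed
  \<comment> \<open>The instance q = 1, as the ray below 1 contains the whole interval; it is what
    the complement case of the Dynkin induction needs.\<close>
  have total: "(\<integral>x. g x \<partial>U) = 0"
  proof -
    have "(\<integral>x. g x \<partial>U) = (\<integral>x. indicator {..<1} x * g x \<partial>U)"
      by (intro Bochner_Integration.integral_cong) auto
    then show ?thesis
      using zero[of 1] by simp
  qed
  have borel_zero: "(\<integral>x. indicator B x * g x \<partial>U) = 0" if "B \<in> sets borel" for B :: "real set"
  proof -
    have sets: "sets borel = sigma_sets UNIV (range (lessThan :: real \<Rightarrow> _))"
      by (subst borel_Iio) simp
    have B: "B \<in> sigma_sets UNIV (range lessThan)"
      using that sets by simp
    have stable: "Int_stable (range (lessThan :: real \<Rightarrow> _))"
    proof (rule Int_stableI_image)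
      show "\<exists>c\<in>UNIV. {..<a} \<inter> {..<b} = {..<c}" for a b :: real
        by (rule bexI[of _ "min a b"]) auto
    qed
    have closed: "range (lessThan :: real \<Rightarrow> _) \<subseteq> Pow UNIV"
      by simp
    from stable closed B show ?thesis
    proof (induction rule: sigma_sets_induct_disjoint)
      case (basic A)
      then obtain a where a: "A = {..<a}"
        by blast
      show ?case
      \<comment> \<open>The hypothesis speaks of 0 < q <= 1 only. Any other ray misses the unit
        interval or cuts out the same set as the ray below 1.\<close>
      proof (cases "a \<le> 0")
        case True
        then have "(\<integral>x. indicator A x * g x \<partial>U) = (\<integral>x. 0 \<partial>U)"
          unfolding a by (intro Bochner_Integration.integral_cong) (auto simp: indicator_def)
        then show ?thesis
          by simp
      next
        case False
        have "(\<integral>x. indicator A x * g x \<partial>U) = (\<integral>x. indicator {..<min a 1} x * g x \<partial>U)"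
          unfolding a by (intro Bochner_Integration.integral_cong) (auto simp: indicator_def)
        then show ?thesis
          using zero False by simp
      qed
    next
      case empty
      then show ?case by simp
    next
      case (compl A)
      then have "A \<in> sets borel"
        using sets by simp
      then have "(\<integral>x. g x - indicator A x * g x \<partial>U) = 0"
        using compl int g total by simp
      moreover have "(\<lambda>x. g x - indicator A x * g x) = (\<lambda>x. indicator (UNIV - A) x * g x)"
        by (auto simp: indicator_def)
      ultimately show ?case
        by simp
    next
      case (union A)
      have A: "A i \<in> sets borel" for i
        using union sets by auto
      have "set_lebesgue_integral U (\<Union>i. A i \<inter> {0<..<1}) g =
          (\<Sum>i. set_lebesgue_integral U (A i \<inter> {0<..<1}) g)"
      proof (rule lebesgue_integral_countable_add)
        show "A i \<inter> {0<..<1} \<in> sets U" for i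
          by (rule borel_U[OF A])
        show "(A i \<inter> {0<..<1}) \<inter> (A j \<inter> {0<..<1}) = {}" if "i \<noteq> j" for i j
          using union that by (auto simp: disjoint_family_on_def)
        have "(\<Union>i. A i \<inter> {0<..<1}) \<in> sets U"
          using borel_U[OF A] by blast
        then show "set_integrable U (\<Union>i. A i \<inter> {0<..<1}) g"
          unfolding set_integrable_def using g by (intro integrable_mult_indicator)
      qed
      moreover have "set_lebesgue_integral U (A i \<inter> {0<..<1}) g = (\<integral>x. indicator (A i) x * g x \<partial>U)" for i
        unfolding set_lebesgue_integral_def
        by (intro Bochner_Integration.integral_cong) (auto simp: indicator_def)
      moreover have "set_lebesgue_integral U (\<Union>i. A i \<inter> {0<..<1}) g =
          (\<integral>x. indicator (\<Union>i. A i) x * g x \<partial>U)"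
        unfolding set_lebesgue_integral_def
        by (intro Bochner_Integration.integral_cong) (auto simp: indicator_def)
      ultimately show ?case
        using union by simp
    qed
  qed
  \<comment> \<open>A Lebesgue set is an F-sigma set, hence a Borel set, up to a null set that the
    integral ignores.\<close>
  fix A assume A: "A \<in> sets U"
  then have "A \<in> sets lebesgue"
    by (simp add: sets_restrict_space_iff)
  then obtain C T where C: "fsigma C" "T \<in> null_sets lebesgue" "C \<union> T = A"
    by (metis lebesgue_set_almost_fsigma)
  have "C \<in> sets borel"
    using C(1) by (auto simp: fsigma.simps)
  have "AE x in lebesgue. x \<notin> T"
    using C(2) by (rule AE_not_in)
  then have "AE x in U. x \<notin> T"
    by (auto simp: AE_restrict_space_iff elim: eventually_mono)
  then have "set_lebesgue_integral U A g = (\<integral>x. indicator C x * g x \<partial>U)"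
    unfolding set_lebesgue_integral_def
    by (intro integral_cong_AE borel_measurable_integrable integrable_mult_indicator A g int[OF \<open>C \<in> sets borel\<close>])
      (use C(3) in \<open>auto simp: indicator_def elim!: eventually_mono\<close>)
  then show "set_lebesgue_integral U A g = 0"
    using borel_zero \<open>C \<in> sets borel\<close> by simp
qed

lemma flat_exp_tendsto_1: "(flat_exp \<longlongrightarrow> 1) at_top"
proof -
  have "((\<lambda>x::real. exp (- (1 / x))) \<longlongrightarrow> exp (- 0)) at_top"
    by (intro tendsto_intros tendsto_divide_0[OF tendsto_const] filterlim_at_top_imp_at_infinity filterlim_ident)
  then have "((\<lambda>x::real. exp (- (1 / x))) \<longlongrightarrow> 1) at_top"
    by simp
  then show ?thesis
    by (rule Lim_transform_eventually)
      (auto simp: flat_exp_def eventually_at_top_linorder intro!: exI[of _ 1])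
qed

text \<open>By \<open>AE_zero_if_integral_Iio_zero\<close> only rays have to be tested. Their
  indicators are bounded pointwise limits of test functions on the interval, so dominated
  convergence with majorant |g| applies.\<close>

lemma AE_zero_if_integral_test_zero:
  fixes g :: "real \<Rightarrow> real"
  assumes g: "integrable U g"
    and zero: "\<And>\<phi>. \<phi> \<in> test_functions \<Longrightarrow> (\<integral>x. g x * \<phi> x \<partial>U) = 0"
  shows "AE x in U. g x = 0"
proof (rule AE_zero_if_integral_Iio_zero[OF g])
  fix q :: real assume q: "0 < q" "q \<le> 1"
  \<comment> \<open>supported in \<open>[1/(n+1), q - 1/(n+1)]\<close> and converging boundedly to the indicator of \<open>(0, q)\<close>\<close>
  define \<phi> where "\<phi> n x = flat_exp (real (Suc n) * x + (- 1)) * flat_exp ((- real (Suc n)) * x + (real (Suc n) * q - 1))"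
    for n x
  have flat01: "0 \<le> flat_exp x" "flat_exp x \<le> 1" for x
    by (auto simp: flat_exp_def)
  have test: "\<phi> n \<in> test_functions" for n
  proof -
    have "\<phi> n x = 0" if "x \<notin> {1 / Suc n..q - 1 / Suc n}" for x
    proof -
      have "real (Suc n) * x + (- 1) \<le> 0 \<or> (- real (Suc n)) * x + (real (Suc n) * q - 1) \<le> 0"
        using that by (auto simp: field_simps)
      then show ?thesis
        by (auto simp: \<phi>_def flat_exp_def)
    qed
    moreover have "smooth (\<phi> n)"
      unfolding \<phi>_def by (intro smooth_mult smooth_affine smooth_flat_exp)
    moreover have pos: "0 < 1 / real (Suc n)"
      by simp
    moreover have "q - 1 / Suc n < 1"
      using q pos by linarith
    \<comment> \<open>For small n the prescribed support interval is empty and the function is zero;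
      the degenerate interval at 1/2 then serves as support.\<close>
    ultimately show ?thesis
      unfolding test_functions_iff
      by (cases "1 / Suc n \<le> q - 1 / Suc n")
        (blast, intro conjI exI[of _ "1/2"], auto)
  qed
  have lim: "(\<lambda>n. \<phi> n x) \<longlonglongrightarrow> indicator {..<q} x" if x: "x \<in> {0<..<1}" for x
  proof (cases "x < q")
    case True
    \<comment> \<open>Both factors have an argument of the form (n+1) y - 1, with y = x and y = q -
      x; both tend to 1 when 0 < x < q.\<close>
    have "filterlim (\<lambda>n. real (Suc n) * y + (- 1)) at_top sequentially" if "0 < y" for y
      using that
      by (subst add.commute, intro filterlim_tendsto_add_at_top[OF tendsto_const]
          filterlim_at_top_mult_tendsto_pos[OF tendsto_const]
          filterlim_compose[OF filterlim_real_sequentially filterlim_Suc])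
    from filterlim_compose[OF flat_exp_tendsto_1 this[of x]]
      filterlim_compose[OF flat_exp_tendsto_1 this[of "q - x"]]
    have "(\<lambda>n. \<phi> n x) \<longlonglongrightarrow> 1 * 1"
      unfolding \<phi>_def using True x by (intro tendsto_mult) (auto simp: algebra_simps)
    then show ?thesis
      using True by simp
  next
    case False
    have "\<phi> n x = 0" for n
    proof -
      have "real (Suc n) * (q - x) \<le> 0"
        using False by (intro mult_nonneg_nonpos) auto
      then have "(- real (Suc n)) * x + (real (Suc n) * q - 1) \<le> 0"
        by (simp add: algebra_simps)
      then show ?thesis
        by (simp add: \<phi>_def flat_exp_def)
    qed
    then show ?thesis
      using False by simp
  qed
  have "(\<lambda>n. \<integral>x. g x * \<phi> n x \<partial>U) \<longlonglongrightarrow> (\<integral>x. indicator {..<q} x * g x \<partial>U)"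
  proof (rule integral_dominated_convergence[where w = "\<lambda>x. \<bar>g x\<bar>"])
    have "AE x in U. (\<lambda>n. g x * \<phi> n x) \<longlonglongrightarrow> g x * indicator {..<q} x"
      using lim by (intro AE_I2 tendsto_mult) auto
    then show "AE x in U. (\<lambda>n. g x * \<phi> n x) \<longlonglongrightarrow> indicator {..<q} x * g x"
      by (simp add: mult.commute)
    show "AE x in U. norm (g x * \<phi> n x) \<le> \<bar>g x\<bar>" for n
      using flat01 by (intro AE_I2) (auto simp: \<phi>_def abs_mult intro!: mult_left_le mult_le_one)
    show "(\<lambda>x. g x * \<phi> n x) \<in> borel_measurable U" for n
      using integrable_mult_test_function[OF g test] by auto
    show "(\<lambda>x. indicator {..<q} x * g x) \<in> borel_measurable U"
      using g by (intro borel_measurable_times) (auto intro!: measurable_restrict_space1 measurable_completion)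
  qed (use g in auto)
  then show "(\<integral>x. indicator {..<q} x * g x \<partial>U) = 0"
    using zero[OF test] by (simp add: LIMSEQ_const_iff)
qed

text \<open>The primitive that starts left of the support is zero there and constant to the right of
  it; mean zero makes that constant vanish, so the primitive has compact support too.\<close>

lemma test_function_antiderivative:
  assumes \<psi>: "\<psi> \<in> test_functions" and zero: "(\<integral>x. \<psi> x \<partial>U) = 0"
  obtains \<phi> where "\<phi> \<in> test_functions" "deriv \<phi> = \<psi>"
proof -
  from \<psi> obtain p q where *: "smooth \<psi>" "0 < p" "p \<le> q" "q < 1" "\<And>x. x \<notin> {p..q} \<Longrightarrow> \<psi> x = 0"
    by (rule test_functionsE) blast
  \<comment> \<open>The base point -1 lies left of the support. For x < -1 the interval is empty and
    the integral is 0, which agrees with the primitive.\<close>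
  define F where "F x = integral {-1..x} \<psi>" for x
  have F0: "F x = 0" if "x < p" for x
  proof -
    have "integral {-1..x} \<psi> = integral {-1..x} (\<lambda>_. 0)"
      using * that by (intro integral_cong) auto
    then show ?thesis
      by (simp add: F_def)
  qed
  have D: "(F has_real_derivative \<psi> x) (at x)" for x
  proof (cases "x < p")
    case True
    show ?thesis
    proof (rule DERIV_cong_ev[OF refl _ refl, THEN iffD1])
      show "\<forall>\<^sub>F y in nhds x. 0 = F y"
        by (rule eventually_mono[OF eventually_nhds_in_open[of "{..<p}"]]) (use True F0 in auto)
      show "((\<lambda>y. 0) has_real_derivative \<psi> x) (at x)"
        using * True by simp
    qed
  next
    case False
    have "(F has_vector_derivative \<psi> x) (at x within {-1..x+1})"
      unfolding F_def using False * by (intro integral_has_vector_derivative smooth_continuous_on) auto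
    moreover have "at x within {-1..x+1} = at x"
      using False * by (intro at_within_interior) auto
    ultimately show ?thesis
      by (simp add: has_real_derivative_iff_has_vector_derivative)
  qed
  have "(F has_real_derivative 0) (at x within {q<..})" if "x \<in> {q<..}" for x
    using D[of x] *(5)[of x] that by (simp add: has_field_derivative_at_within)
  then obtain c where c: "\<And>x. x \<in> {q<..} \<Longrightarrow> F x = c"
    using has_field_derivative_zero_constant[of "{q<..}" F] by fastforce
  moreover have "F 1 = 0"
    using integral_deriv_U[OF D integrable_test_function[OF \<psi>]] F0[of 0] zero * by simp
  ultimately have F1: "F x = 0" if "q < x" for x
    using that *(4) c[of x] c[of 1] by simp
  have "F \<in> test_functions"
    unfolding test_functions_iff using smooth_antiderivative[OF D *(1)] * F0 F1
    by (intro conjI exI[of _ p] exI[of _ q]) (auto simp: not_le)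
  moreover have "deriv F = \<psi>"
    using D DERIV_imp_deriv by blast
  ultimately show ?thesis
    using that by blast
qed

subsection \<open>Weak derivatives and weak solutions\<close>

lemma L2_measurable: "f \<in> L2 \<Longrightarrow> f \<in> borel_measurable U"
  and L2_integrable_square: "f \<in> L2 \<Longrightarrow> integrable U (\<lambda>x. (f x)\<^sup>2)"
  by (auto simp: L2_def)

lemma L2_integrable:
  assumes "f \<in> L2"
  shows "integrable U f"
proof (rule Bochner_Integration.integrable_bound[where f = "\<lambda>x. 1 + (f x)\<^sup>2"])
  show "AE x in U. norm (f x) \<le> norm (1 + (f x)\<^sup>2)"
  proof (rule AE_I2)
    fix x
    have "0 \<le> (\<bar>f x\<bar> - 1)\<^sup>2"
      by simp
    then show "norm (f x) \<le> norm (1 + (f x)\<^sup>2)"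
      by (simp add: power2_diff)
  qed
qed (use assms in \<open>auto simp: L2_def\<close>)

lemma L2_diff:
  assumes "f \<in> L2" "g \<in> L2"
  shows "(\<lambda>x. f x - g x) \<in> L2"
proof -
  have [measurable]: "f \<in> borel_measurable U" "g \<in> borel_measurable U"
    using assms by (auto simp: L2_def)
  have "integrable U (\<lambda>x. (f x - g x)\<^sup>2)"
  proof (rule Bochner_Integration.integrable_bound[where f = "\<lambda>x. 2 * (f x)\<^sup>2 + 2 * (g x)\<^sup>2"])
    show "AE x in U. norm ((f x - g x)\<^sup>2) \<le> norm (2 * (f x)\<^sup>2 + 2 * (g x)\<^sup>2)"
    proof (rule AE_I2)
      fix x
      have "(f x - g x)\<^sup>2 + (f x + g x)\<^sup>2 = 2 * (f x)\<^sup>2 + 2 * (g x)\<^sup>2"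
        by (simp add: power2_diff power2_sum)
      then have "(f x - g x)\<^sup>2 \<le> 2 * (f x)\<^sup>2 + 2 * (g x)\<^sup>2"
        by (smt (verit) zero_le_power2)
      then show "norm ((f x - g x)\<^sup>2) \<le> norm (2 * (f x)\<^sup>2 + 2 * (g x)\<^sup>2)"
        by simp
    qed
  qed (use assms in \<open>auto simp: L2_def\<close>)
  then show ?thesis
    by (simp add: L2_def)
qed

lemma bounded_imp_L2:
  assumes [measurable]: "f \<in> borel_measurable U" and "AE x in U. \<bar>f x\<bar> \<le> B"
  shows "f \<in> L2"
proof -
  have "AE x in U. norm ((f x)\<^sup>2) \<le> B\<^sup>2"
    using assms(2) by eventually_elim (simp add: abs_le_square_iff[symmetric])
  then have "integrable U (\<lambda>x. (f x)\<^sup>2)"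
    by (intro U.integrable_const_bound) auto
  then show ?thesis
    by (simp add: L2_def)
qed

lemma test_functions_L2:
  assumes "\<phi> \<in> test_functions"
  shows "\<phi> \<in> L2"
proof -
  obtain M where "\<And>x. \<bar>\<phi> x\<bar> \<le> M"
    using test_functions_bounded[OF assms] by blast
  then show ?thesis
    by (intro bounded_imp_L2[where B = M] test_functions_measurable assms AE_I2)
qed

lemma L2_norm_cong_AE:
  assumes "f \<in> L2" "g \<in> L2" "AE x in U. f x = g x"
  shows "L2_norm f = L2_norm g"
  unfolding L2_norm_def
  by (intro arg_cong[where f = sqrt] integral_cong_AE borel_measurable_power L2_measurable assms)
    (use assms(3) in \<open>eventually_elim, simp\<close>)

lemma L2_norm_nonneg: "0 \<le> L2_norm f"
  by (simp add: L2_norm_def)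

lemma L2_norm_square: "(L2_norm f)\<^sup>2 = (\<integral>x. (f x)\<^sup>2 \<partial>U)"
  by (simp add: L2_norm_def)

lemma L2_norm_eq_0_iff: "f \<in> L2 \<Longrightarrow> L2_norm f = 0 \<longleftrightarrow> (AE x in U. f x = 0)"
  unfolding L2_norm_def by (simp add: integral_nonneg_eq_0_iff_AE L2_integrable_square)

text \<open>\<open>U\<close> has total mass 1, so this is nonnegativity of the variance.\<close>

lemma integral_abs_le_L2_norm:
  assumes "f \<in> L2"
  shows "\<bar>\<integral>x. f x \<partial>U\<bar> \<le> L2_norm f"
proof -
  define m where "m = (\<integral>x. f x \<partial>U)"
  have [simp]: "integrable U f" "integrable U (\<lambda>x. (f x)\<^sup>2)"
    using assms by (auto intro: L2_integrable L2_integrable_square)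
  have "0 \<le> (\<integral>x. (f x - m)\<^sup>2 \<partial>U)"
    by simp
  also have "\<dots> = (\<integral>x. (f x)\<^sup>2 - 2 * m * f x + m\<^sup>2 \<partial>U)"
    by (intro Bochner_Integration.integral_cong) (auto simp: power2_diff algebra_simps)
  also have "\<dots> = (\<integral>x. (f x)\<^sup>2 \<partial>U) - 2 * m * m + m\<^sup>2"
    using measure_U[of 0 1] by (simp add: m_def[symmetric])
  also have "\<dots> = (\<integral>x. (f x)\<^sup>2 \<partial>U) - m\<^sup>2"
    by (simp add: power2_eq_square)
  finally show ?thesis
    unfolding m_def[symmetric] L2_norm_def by (intro real_le_rsqrt) simp
qed

section \<open>Weak derivatives and the energy space\<close>

text \<open>The difference of the two derivatives annihilates every test function. Allowing two
  functions that agree almost everywhere lets the lemma also transfer equality of solutions to their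
  derivatives.\<close>

lemma is_weak_derivative_unique:
  assumes u: "u \<in> L2" "v \<in> L2" "AE x in U. u x = v x"
    and g: "g \<in> L2" "is_weak_derivative u g" and h: "h \<in> L2" "is_weak_derivative v h"
  shows "AE x in U. g x = h x"
proof -
  have "AE x in U. g x - h x = 0"
  proof (rule AE_zero_if_integral_test_zero)
    show "integrable U (\<lambda>x. g x - h x)"
      using g h L2_integrable by simp
    fix \<phi> assume \<phi>: "\<phi> \<in> test_functions"
    have "(\<integral>x. u x * deriv \<phi> x \<partial>U) = (\<integral>x. v x * deriv \<phi> x \<partial>U)"
      by (intro integral_cong_AE borel_measurable_times L2_measurable u test_functions_L2
          test_functions_deriv \<phi>)
        (use u(3) in \<open>eventually_elim, simp\<close>)
    then have "(\<integral>x. g x * \<phi> x \<partial>U) = (\<integral>x. h x * \<phi> x \<partial>U)"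
      using g h \<phi> by (simp add: is_weak_derivative_def)
    moreover have "integrable U (\<lambda>x. g x * \<phi> x)" "integrable U (\<lambda>x. h x * \<phi> x)"
      using g h \<phi> by (auto intro: integrable_mult_test_function L2_integrable)
    ultimately show "(\<integral>x. (g x - h x) * \<phi> x \<partial>U) = 0"
      by (simp add: left_diff_distrib)
  qed
  then show ?thesis
    by simp
qed

lemma is_weak_derivative_diff:
  assumes "u \<in> L2" "v \<in> L2" "g \<in> L2" "h \<in> L2"
    and "is_weak_derivative u g" "is_weak_derivative v h"
  shows "is_weak_derivative (\<lambda>x. u x - v x) (\<lambda>x. g x - h x)"
  unfolding is_weak_derivative_def
proof
  fix \<phi> assume \<phi>: "\<phi> \<in> test_functions"
  have "integrable U (\<lambda>x. w x * \<phi> x)" "integrable U (\<lambda>x. w x * deriv \<phi> x)" if "w \<in> L2" for w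
    using that \<phi> by (auto intro: integrable_mult_test_function L2_integrable test_functions_deriv)
  then show "(\<integral>x. (u x - v x) * deriv \<phi> x \<partial>U) = - (\<integral>x. (g x - h x) * \<phi> x \<partial>U)"
    using assms \<phi> by (simp add: left_diff_distrib is_weak_derivative_def)
qed

lemma H1_L2: "u \<in> H1 \<Longrightarrow> u \<in> L2"
  by (simp add: H1_def)

lemma
  assumes "u \<in> H1"
  shows weak_deriv_L2: "weak_deriv u \<in> L2"
    and weak_deriv_is_weak_derivative: "is_weak_derivative u (weak_deriv u)"
proof -
  have "\<exists>g. g \<in> L2 \<and> is_weak_derivative u g"
    using assms by (auto simp: H1_def)
  then have "weak_deriv u \<in> L2 \<and> is_weak_derivative u (weak_deriv u)"
    unfolding weak_deriv_def by (rule someI_ex)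
  then show "weak_deriv u \<in> L2" "is_weak_derivative u (weak_deriv u)"
    by blast+
qed

text \<open>Makes the choice in \<open>weak_deriv\<close> harmless: facts are proved for an explicit
  weak derivative and then carried over almost everywhere.\<close>

lemma weak_deriv_AE_eq:
  assumes "u \<in> L2" "g \<in> L2" "is_weak_derivative u g"
  shows "AE x in U. weak_deriv u x = g x"
proof -
  have "u \<in> H1"
    using assms by (auto simp: H1_def)
  note * = weak_deriv_L2[OF this] weak_deriv_is_weak_derivative[OF this]
  show ?thesis
    by (rule is_weak_derivative_unique[OF assms(1) assms(1) _ * assms(2,3)]) simp
qed

lemma
  assumes "u \<in> H1" "v \<in> H1"
  shows H1_diff: "(\<lambda>x. u x - v x) \<in> H1"
    and weak_deriv_diff: "AE x in U. weak_deriv (\<lambda>x. u x - v x) x = weak_deriv u x - weak_deriv v x"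
proof -
  note * = assms[THEN H1_L2] assms[THEN weak_deriv_L2]
  note ** = is_weak_derivative_diff[OF * assms[THEN weak_deriv_is_weak_derivative]]
  show "(\<lambda>x. u x - v x) \<in> H1"
    unfolding H1_def by (intro CollectI conjI bexI[where P = "is_weak_derivative _", OF **] L2_diff *)
  show "AE x in U. weak_deriv (\<lambda>x. u x - v x) x = weak_deriv u x - weak_deriv v x"
    by (intro weak_deriv_AE_eq L2_diff * **)
qed

lemma test_functions_is_weak_derivative:
  assumes "\<phi> \<in> test_functions"
  shows "is_weak_derivative \<phi> (deriv \<phi>)"
  unfolding is_weak_derivative_def
  by (intro ballI integral_by_parts_test_function test_functions_smooth assms)

lemma test_functions_H1: "\<phi> \<in> test_functions \<Longrightarrow> \<phi> \<in> H1"
  unfolding H1_def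
  by (intro CollectI conjI bexI[of _ "deriv \<phi>"] test_functions_L2 test_functions_is_weak_derivative
      test_functions_deriv)

lemma weak_deriv_test_function:
  "\<phi> \<in> test_functions \<Longrightarrow> AE x in U. weak_deriv \<phi> x = deriv \<phi> x"
  by (intro weak_deriv_AE_eq test_functions_L2 test_functions_is_weak_derivative test_functions_deriv)

lemma test_functions_H10:
  assumes "\<phi> \<in> test_functions"
  shows "\<phi> \<in> H10"
proof -
  note H1 = test_functions_H1[OF assms]
  \<comment> \<open>The constant sequence approximates \<phi>. Even for the zero function the chosen
    weak derivative is known to vanish only almost everywhere.\<close>
  have "AE x in U. weak_deriv (\<lambda>x. \<phi> x - \<phi> x) x = 0"
    using weak_deriv_diff[OF H1 H1] by simp
  moreover have "weak_deriv (\<lambda>x. \<phi> x - \<phi> x) \<in> L2"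
    by (rule weak_deriv_L2[OF H1_diff[OF H1 H1]])
  ultimately have "H1_norm (\<lambda>x. \<phi> x - \<phi> x) = 0"
    by (simp add: H1_norm_def L2_norm_eq_0_iff) (simp add: L2_norm_def)
  then show ?thesis
    using H1 assms by (auto simp: H10_def intro!: exI[of _ "\<lambda>_. \<phi>"])
qed

text \<open>This is how the boundary condition of a solution enters: derivatives of test functions
  have mean zero, and the mean is continuous in the \<open>H1_norm\<close>.\<close>

lemma integral_weak_deriv_H10:
  assumes "u \<in> H10"
  shows "(\<integral>x. weak_deriv u x \<partial>U) = 0"
proof -
  from assms obtain \<phi> :: "nat \<Rightarrow> real \<Rightarrow> real" where u: "u \<in> H1"
    and \<phi>: "\<And>n. \<phi> n \<in> test_functions" and lim: "(\<lambda>n. H1_norm (\<lambda>x. u x - \<phi> n x)) \<longlonglongrightarrow> 0"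
    by (auto simp: H10_def)
  have "\<bar>\<integral>x. weak_deriv u x \<partial>U\<bar> \<le> H1_norm (\<lambda>x. u x - \<phi> n x)" for n
  proof -
    note w = H1_diff[OF u test_functions_H1[OF \<phi>[of n]]]
    have ae: "AE x in U. weak_deriv (\<lambda>x. u x - \<phi> n x) x = weak_deriv u x - deriv (\<phi> n) x"
      using weak_deriv_diff[OF u test_functions_H1[OF \<phi>[of n]]] weak_deriv_test_function[OF \<phi>[of n]]
      by eventually_elim simp
    have "(\<integral>x. weak_deriv u x \<partial>U) = (\<integral>x. weak_deriv u x - deriv (\<phi> n) x \<partial>U)"
      using integral_deriv_test_function[OF \<phi>] L2_integrable[OF weak_deriv_L2[OF u]]
        integrable_test_function[OF test_functions_deriv[OF \<phi>]] by simp
    also have "\<dots> = (\<integral>x. weak_deriv (\<lambda>x. u x - \<phi> n x) x \<partial>U)"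
      by (intro integral_cong_AE borel_measurable_diff L2_measurable weak_deriv_L2 w u
          test_functions_L2 test_functions_deriv \<phi>)
        (use ae in \<open>eventually_elim, simp\<close>)
    finally have "\<bar>\<integral>x. weak_deriv u x \<partial>U\<bar> \<le> L2_norm (weak_deriv (\<lambda>x. u x - \<phi> n x))"
      using integral_abs_le_L2_norm[OF weak_deriv_L2[OF w]] by simp
    also have "\<dots> \<le> H1_norm (\<lambda>x. u x - \<phi> n x)"
      unfolding H1_norm_def by (intro real_le_rsqrt) simp
    finally show ?thesis .
  qed
  then have "\<bar>\<integral>x. weak_deriv u x \<partial>U\<bar> \<le> 0"
    by (intro LIMSEQ_le_const[OF lim]) auto
  then show ?thesis
    by simp
qed

lemma not_AE_U_False: "\<not> (AE x in U. False)"
proof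
  assume "AE x in U. False"
  then have "(\<integral>x. (1::real) \<partial>U) = (\<integral>x. 0 \<partial>U)"
    by (intro integral_cong_AE) auto
  then show False
    using measure_U[of 0 1] by simp
qed

section \<open>The explicit flux\<close>

text \<open>Subtracting a multiple of a fixed \<rho> turns any test function into one of mean zero,
  which is the derivative of a test function and hence annihilated by w. So w - c annihilates all
  test functions.\<close>

lemma du_Bois_Reymond:
  assumes w: "integrable U w"
    and zero: "\<And>\<phi>. \<phi> \<in> test_functions \<Longrightarrow> (\<integral>x. w x * deriv \<phi> x \<partial>U) = 0"
  obtains c :: real where "AE x in U. w x = c"
proof -
  \<comment> \<open>No bump function is built: if all means vanished, the fundamental lemma would
    force the constant 1 to be zero.\<close>
  have "\<exists>\<rho>\<in>test_functions. (\<integral>x. \<rho> x \<partial>U) \<noteq> 0"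
  proof (rule ccontr)
    assume "\<not> ?thesis"
    then have "AE x in U. (1::real) = 0"
      by (intro AE_zero_if_integral_test_zero) auto
    then show False
      using not_AE_U_False by simp
  qed
  then obtain \<rho> where \<rho>: "\<rho> \<in> test_functions" "(\<integral>x. \<rho> x \<partial>U) \<noteq> 0"
    by blast
  define I where "I = (\<integral>x. \<rho> x \<partial>U)"
  \<comment> \<open>The only possible value, found by testing w = c against \<rho>.\<close>
  define c where "c = (\<integral>x. w x * \<rho> x \<partial>U) / I"
  have "AE x in U. w x - c = 0"
  proof (rule AE_zero_if_integral_test_zero)
    show "integrable U (\<lambda>x. w x - c)"
      using w by simp
    fix \<psi> assume \<psi>: "\<psi> \<in> test_functions"
    define J where "J = (\<integral>x. \<psi> x \<partial>U)"
    have int: "integrable U \<psi>" "integrable U \<rho>" "integrable U (\<lambda>x. w x * \<psi> x)" "integrable U (\<lambda>x. w x * \<rho> x)"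
      using \<psi> \<rho> w by (auto intro: integrable_test_function integrable_mult_test_function)
    have "(\<lambda>x. \<psi> x + (- (J / I)) * \<rho> x) \<in> test_functions"
      by (intro test_functions_add test_functions_mult smooth_const \<psi> \<rho>)
    moreover have "(\<integral>x. \<psi> x + (- (J / I)) * \<rho> x \<partial>U) = 0"
      using int \<rho> by (simp add: I_def J_def)
    ultimately obtain \<phi> where "\<phi> \<in> test_functions" "deriv \<phi> = (\<lambda>x. \<psi> x + (- (J / I)) * \<rho> x)"
      using test_function_antiderivative by blast
    then have "(\<integral>x. w x * (\<psi> x + (- (J / I)) * \<rho> x) \<partial>U) = 0"
      using zero by metis
    moreover have "(\<lambda>x. w x * (\<psi> x + (- (J / I)) * \<rho> x)) = (\<lambda>x. w x * \<psi> x - (J / I) * (w x * \<rho> x))"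
      by (auto simp: algebra_simps)
    ultimately have "(\<integral>x. w x * \<psi> x \<partial>U) = J * c"
      using int by (simp add: c_def)
    then show "(\<integral>x. (w x - c) * \<psi> x \<partial>U) = 0"
      using int by (simp add: left_diff_distrib J_def)
  qed
  then show ?thesis
    using that[of c] by simp
qed

lemma coefficientsD:
  assumes "a \<in> coefficients l L"
  shows "a \<in> borel_measurable U" "AE x in U. l \<le> a x \<and> a x \<le> L"
  using assms by (auto simp: coefficients_def L_infinity_def)

lemma coefficients_L2:
  assumes "a \<in> coefficients l L" "0 < l"
  shows "a \<in> L2"
proof (rule bounded_imp_L2[OF coefficientsD(1)[OF assms(1)]])
  show "AE x in U. \<bar>a x\<bar> \<le> L"
    using coefficientsD(2)[OF assms(1)] by eventually_elim (use assms(2) in auto)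
qed

text \<open>Since x \<phi>' integrates to minus the integral of \<phi>, the weak equation says that
  a u' + x annihilates all derivatives of test functions; \<open>du_Bois_Reymond\<close> makes it
  constant.\<close>

lemma weak_solution_flux:
  assumes a: "a \<in> coefficients l L" "0 < l" and u: "is_weak_solution a (\<lambda>x. 1) u"
  obtains c where "AE x in U. a x * weak_deriv u x = c - x"
proof -
  have uH: "u \<in> H1"
    using u by (simp add: is_weak_solution_def H10_def)
  have aE: "AE x in U. \<bar>a x\<bar> \<le> L"
    using coefficientsD(2)[OF a(1)] by eventually_elim (use a(2) in auto)
  have int: "integrable U (\<lambda>x. a x * weak_deriv u x)"
    using integrable_mult_bounded[OF L2_integrable[OF weak_deriv_L2[OF uH]] coefficientsD(1)[OF a(1)] aE]
    by (simp add: mult.commute)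
  have id: "smooth (\<lambda>x. x)"
    by (rule smooth_antiderivative[OF _ smooth_const]) (rule DERIV_ident)
  have intx: "integrable U (\<lambda>x. x)"
  proof (rule U.integrable_const_bound[where B = 1])
    show "AE x in U. norm x \<le> 1"
      by (rule AE_I2) auto
    show "(\<lambda>x. x) \<in> borel_measurable U"
      by (intro continuous_measurable_U continuous_intros)
  qed
  obtain c where "AE x in U. a x * weak_deriv u x + x = c"
  proof (rule du_Bois_Reymond)
    show "integrable U (\<lambda>x. a x * weak_deriv u x + x)"
      using int intx by simp
    fix \<phi> assume \<phi>: "\<phi> \<in> test_functions"
    have int': "integrable U (\<lambda>x. a x * weak_deriv u x * deriv \<phi> x)" "integrable U (\<lambda>x. x * deriv \<phi> x)"
      by (rule integrable_mult_test_function[OF int test_functions_deriv[OF \<phi>]],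
          rule integrable_mult_test_function[OF intx test_functions_deriv[OF \<phi>]])
    have "(\<integral>x. \<phi> x \<partial>U) = (\<integral>x. a x * weak_deriv u x * weak_deriv \<phi> x \<partial>U)"
      using u test_functions_H10[OF \<phi>] by (simp add: is_weak_solution_def)
    also have "\<dots> = (\<integral>x. a x * weak_deriv u x * deriv \<phi> x \<partial>U)"
      by (intro integral_cong_AE borel_measurable_times coefficientsD(1)[OF a(1)]
          weak_deriv_L2[OF uH, THEN L2_measurable]
          weak_deriv_L2[OF test_functions_H1[OF \<phi>], THEN L2_measurable]
          test_functions_measurable[OF test_functions_deriv[OF \<phi>]])
        (use weak_deriv_test_function[OF \<phi>] in \<open>eventually_elim, simp\<close>)
    finally have "(\<integral>x. a x * weak_deriv u x * deriv \<phi> x \<partial>U) = (\<integral>x. \<phi> x \<partial>U)" ..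
    moreover have "(\<integral>x. x * deriv \<phi> x \<partial>U) = - (\<integral>x. \<phi> x \<partial>U)"
      using integral_by_parts_test_function[OF \<phi> id] by simp
    ultimately show "(\<integral>x. (a x * weak_deriv u x + x) * deriv \<phi> x \<partial>U) = 0"
      using int' by (simp add: distrib_right)
  qed
  then have "AE x in U. a x * weak_deriv u x = c - x"
    by eventually_elim simp
  then show ?thesis
    using that by blast
qed

text \<open>For c outside [0,1] the flux c - x, and with it u', would have one strict sign almost
  everywhere, against its mean zero.\<close>

lemma weak_solution_flux_unit:
  assumes a: "a \<in> coefficients l L" "0 < l" and u: "is_weak_solution a (\<lambda>x. 1) u"
  obtains c where "0 \<le> c" "c \<le> 1" "AE x in U. a x * weak_deriv u x = c - x"
proof -
  obtain c where c: "AE x in U. a x * weak_deriv u x = c - x"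
    using weak_solution_flux[OF a u] by blast
  have H: "u \<in> H10" "u \<in> H1"
    using u by (auto simp: is_weak_solution_def H10_def)
  define g where "g = weak_deriv u"
  have int: "integrable U g" and zero: "(\<integral>x. g x \<partial>U) = 0"
    using L2_integrable[OF weak_deriv_L2[OF H(2)]] integral_weak_deriv_H10[OF H(1)] by (auto simp: g_def)
  have unit: "AE x in U. x \<in> {0<..<1}"
    by (rule AE_I2) auto
  have False if "c < 0"
  proof -
    have neg: "AE x in U. 0 < - g x"
      using c coefficientsD(2)[OF a(1)] unit
    proof eventually_elim
      case (elim x)
      then have "a x * g x < 0" "0 < a x"
        using that a(2) by (auto simp: g_def)
      then show ?case
        by (simp add: mult_less_0_iff)
    qed
    then have "AE x in U. 0 \<le> - g x"
      by eventually_elim simp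
    then have "AE x in U. - g x = 0"
      using integral_nonneg_eq_0_iff_AE[of U "\<lambda>x. - g x"] int zero by simp
    with neg have "AE x in U. False"
      by eventually_elim simp
    then show False
      using not_AE_U_False by blast
  qed
  moreover have False if "1 < c"
  proof -
    have pos: "AE x in U. 0 < g x"
      using c coefficientsD(2)[OF a(1)] unit
    proof eventually_elim
      case (elim x)
      then have "a x * g x > 0" "0 < a x"
        using that a(2) by (auto simp: g_def)
      then show ?case
        by (simp add: zero_less_mult_iff)
    qed
    then have "AE x in U. 0 \<le> g x"
      by eventually_elim simp
    then have "AE x in U. g x = 0"
      using integral_nonneg_eq_0_iff_AE[of U g] int zero by simp
    with pos have "AE x in U. False"
      by eventually_elim simp
    then show False
      using not_AE_U_False by blast
  qed
  ultimately show ?thesis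
    using that[of c] c by force
qed

subsection \<open>The stability estimate\<close>

text \<open>The gap \<beta> - \<alpha> bounds L |A - B| from below on an interval whose length is
  that same gap; integrating the square gives the cube.\<close>

lemma flux_constants_close_ordered:
  fixes A B :: "real \<Rightarrow> real"
  assumes l: "0 < l" and AB: "A \<in> L2" "B \<in> L2"
    and a: "AE x in U. l \<le> a x \<and> a x \<le> L" and b: "AE x in U. l \<le> b x \<and> b x \<le> L"
    and A: "AE x in U. a x * A x = \<alpha> - x" and B: "AE x in U. b x * B x = \<beta> - x"
    and \<alpha>\<beta>: "0 \<le> \<alpha>" "\<alpha> \<le> \<beta>" "\<beta> \<le> 1"
  shows "(\<beta> - \<alpha>) ^ 3 \<le> L\<^sup>2 * (L2_norm (\<lambda>x. A x - B x))\<^sup>2"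
proof -
  have "(\<integral>x. (\<beta> - \<alpha>)\<^sup>2 * indicator {\<alpha><..<\<beta>} x \<partial>U) \<le> (\<integral>x. L\<^sup>2 * (A x - B x)\<^sup>2 \<partial>U)"
  proof (rule integral_mono_AE)
    have "{\<alpha><..<\<beta>} \<in> sets U"
      using \<alpha>\<beta> by (auto simp: sets_restrict_space_iff)
    then show "integrable U (\<lambda>x. (\<beta> - \<alpha>)\<^sup>2 * indicator {\<alpha><..<\<beta>} x)"
      by (intro integrable_mult_right integrable_real_indicator) (auto simp flip: less_top)
    show "integrable U (\<lambda>x. L\<^sup>2 * (A x - B x)\<^sup>2)"
      by (intro integrable_mult_right L2_integrable_square L2_diff AB)
    show "AE x in U. (\<beta> - \<alpha>)\<^sup>2 * indicator {\<alpha><..<\<beta>} x \<le> L\<^sup>2 * (A x - B x)\<^sup>2"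
      using a b A B
    proof eventually_elim
      case (elim x)
      show ?case
      proof (cases "x \<in> {\<alpha><..<\<beta>}")
        case True
        have "A x \<le> 0" "0 \<le> B x"
          using elim l True by (smt (verit) mult_pos_pos greaterThanLessThan_iff, smt (verit) mult_pos_neg greaterThanLessThan_iff)
        moreover have "a x \<le> L" "b x \<le> L"
          using elim by auto
        \<comment> \<open>Opposite signs let the upper bound L act on both terms: it enlarges b B
          and, as A is nonpositive, makes L A the smaller one. Subtracting the fluxes leaves \<beta>
          - \<alpha>.\<close>
        ultimately have "L * A x \<le> a x * A x" "b x * B x \<le> L * B x"
          by (auto intro: mult_right_mono mult_right_mono_neg)
        then have "\<beta> - \<alpha> \<le> L * (B x - A x)"
          using elim by (simp add: right_diff_distrib)
        then have "(\<beta> - \<alpha>)\<^sup>2 \<le> (L * (B x - A x))\<^sup>2"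
          using \<alpha>\<beta> by (intro power_mono) auto
        then show ?thesis
          using True by (simp add: power_mult_distrib power2_commute)
      qed auto
    qed
  qed
  moreover have "(\<integral>x. (\<beta> - \<alpha>)\<^sup>2 * indicator {\<alpha><..<\<beta>} x \<partial>U) = (\<beta> - \<alpha>) ^ 3"
  proof -
    have "(\<integral>x. indicator {\<alpha><..<\<beta>} x \<partial>U) = \<beta> - \<alpha>"
      using \<alpha>\<beta> measure_U[of \<alpha> \<beta>] by (simp add: Int_absorb2)
    then show ?thesis
      by (simp add: power2_eq_square power3_eq_cube)
  qed
  ultimately show ?thesis
    by (simp add: L2_norm_square)
qed

lemma flux_constants_close:
  fixes A B :: "real \<Rightarrow> real"
  assumes l: "0 < l" and AB: "A \<in> L2" "B \<in> L2"
    and a: "AE x in U. l \<le> a x \<and> a x \<le> L" and b: "AE x in U. l \<le> b x \<and> b x \<le> L"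
    and A: "AE x in U. a x * A x = \<alpha> - x" and B: "AE x in U. b x * B x = \<beta> - x"
    and \<alpha>\<beta>: "0 \<le> \<alpha>" "\<alpha> \<le> 1" "0 \<le> \<beta>" "\<beta> \<le> 1"
  shows "\<bar>\<alpha> - \<beta>\<bar> ^ 3 \<le> L\<^sup>2 * (L2_norm (\<lambda>x. A x - B x))\<^sup>2"
proof (cases "\<alpha> \<le> \<beta>")
  case True
  then show ?thesis
    using flux_constants_close_ordered[OF l AB a b A B] \<alpha>\<beta> by simp
next
  case False
  have "L2_norm (\<lambda>x. B x - A x) = L2_norm (\<lambda>x. A x - B x)"
    unfolding L2_norm_def by (subst power2_commute) (rule refl)
  then show ?thesis
    using flux_constants_close_ordered[OF l AB(2,1) b a B A] \<alpha>\<beta> False by simp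
qed

text \<open>Multiplying by r^2 avoids dividing by the small derivative A near its zero \<alpha>. The
  excluded neighbourhood has length at most 2 r, which gives the r^3 term.\<close>

lemma coefficient_difference_split:
  fixes A B :: "real \<Rightarrow> real"
  assumes l: "0 < l" and AB: "A \<in> L2" "B \<in> L2" and ab: "a \<in> L2" "b \<in> L2"
    and a: "AE x in U. l \<le> a x \<and> a x \<le> L" and b: "AE x in U. l \<le> b x \<and> b x \<le> L"
    and A: "AE x in U. a x * A x = \<alpha> - x" and B: "AE x in U. b x * B x = \<beta> - x"
    and \<alpha>: "0 \<le> \<alpha>" "\<alpha> \<le> 1" and r: "0 < r"
  shows "r\<^sup>2 * (L2_norm (\<lambda>x. a x - b x))\<^sup>2 \<le>
    2 * r ^ 3 * L\<^sup>2 + 2 * L\<^sup>2 * ((\<alpha> - \<beta>)\<^sup>2 + L\<^sup>2 * (L2_norm (\<lambda>x. A x - B x))\<^sup>2)"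
proof -
  \<comment> \<open>The interval of radius r about \<alpha>, clipped to the unit interval so that
    \<open>measure_U\<close> gives its measure.\<close>
  define p q where "p = max 0 (\<alpha> - r)" and "q = min 1 (\<alpha> + r)"
  have pq: "p \<le> q" "0 \<le> p" "q \<le> 1" "q - p \<le> 2 * r"
    using \<alpha> r by (auto simp: p_def q_def)
  have meas: "{p<..<q} \<in> sets U"
    using pq by (auto simp: sets_restrict_space_iff)
  have int: "integrable U (\<lambda>x. (A x - B x)\<^sup>2)" "integrable U (\<lambda>x. (a x - b x)\<^sup>2)"
    "integrable U (indicator {p<..<q} :: real \<Rightarrow> real)"
    using AB ab meas
    by (auto intro!: L2_integrable_square L2_diff integrable_real_indicator simp flip: less_top)
  have unit: "AE x in U. x \<in> {0<..<1}"
    by (rule AE_I2) auto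
  have "(\<integral>x. r\<^sup>2 * (a x - b x)\<^sup>2 \<partial>U) \<le>
      (\<integral>x. r\<^sup>2 * L\<^sup>2 * indicator {p<..<q} x + (2 * L\<^sup>2 * (\<alpha> - \<beta>)\<^sup>2 + 2 * L\<^sup>2 * L\<^sup>2 * (A x - B x)\<^sup>2) \<partial>U)"
  proof (rule integral_mono_AE)
    show "AE x in U. r\<^sup>2 * (a x - b x)\<^sup>2 \<le>
        r\<^sup>2 * L\<^sup>2 * indicator {p<..<q} x + (2 * L\<^sup>2 * (\<alpha> - \<beta>)\<^sup>2 + 2 * L\<^sup>2 * L\<^sup>2 * (A x - B x)\<^sup>2)"
      using a b A B unit
    proof eventually_elim
      case (elim x)
      show ?case
      proof (cases "x \<in> {p<..<q}")
        case True
        have "\<bar>a x - b x\<bar> \<le> L"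
          using elim l by auto
        then have "(a x - b x)\<^sup>2 \<le> L\<^sup>2"
          using elim l by (intro abs_le_square_iff[THEN iffD1]) auto
        then have "r\<^sup>2 * (a x - b x)\<^sup>2 \<le> r\<^sup>2 * L\<^sup>2"
          by (rule mult_left_mono) simp
        moreover have "0 \<le> 2 * L\<^sup>2 * (\<alpha> - \<beta>)\<^sup>2 + 2 * L\<^sup>2 * L\<^sup>2 * (A x - B x)\<^sup>2"
          by simp
        ultimately have "r\<^sup>2 * (a x - b x)\<^sup>2 \<le>
            r\<^sup>2 * L\<^sup>2 * 1 + (2 * L\<^sup>2 * (\<alpha> - \<beta>)\<^sup>2 + 2 * L\<^sup>2 * L\<^sup>2 * (A x - B x)\<^sup>2)"
          by linarith
        then show ?thesis
          using True by simp
      next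
        case False
        then have "r \<le> \<bar>\<alpha> - x\<bar>"
          using elim r \<alpha> by (auto simp: p_def q_def max_def min_def split: if_splits)
        also have "\<dots> = \<bar>a x\<bar> * \<bar>A x\<bar>"
          using elim by (simp flip: abs_mult)
        also have "\<dots> \<le> L * \<bar>A x\<bar>"
          using elim l by (intro mult_right_mono) auto
        finally have "r\<^sup>2 \<le> (L * \<bar>A x\<bar>)\<^sup>2"
          using r by (intro power_mono) auto
        then have "r\<^sup>2 * (a x - b x)\<^sup>2 \<le> (L * \<bar>A x\<bar>)\<^sup>2 * (a x - b x)\<^sup>2"
          by (rule mult_right_mono) simp
        also have "\<dots> = L\<^sup>2 * ((a x - b x) * A x)\<^sup>2"
          by (simp add: power_mult_distrib)
        \<comment> \<open>Subtracting the two flux equations cancels x: a A - b B = \<alpha> -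
          \<beta>.\<close>
        also have "(a x - b x) * A x = (\<alpha> - \<beta>) - b x * (A x - B x)"
          using elim by (simp add: algebra_simps)
        also have "L\<^sup>2 * ((\<alpha> - \<beta>) - b x * (A x - B x))\<^sup>2 \<le>
            L\<^sup>2 * (2 * (\<alpha> - \<beta>)\<^sup>2 + 2 * (L\<^sup>2 * (A x - B x)\<^sup>2))"
        proof (rule mult_left_mono)
          \<comment> \<open>The parallelogram identity; dropping the square of the sum leaves the
            factors 2.\<close>
          have "((\<alpha> - \<beta>) - b x * (A x - B x))\<^sup>2 + ((\<alpha> - \<beta>) + b x * (A x - B x))\<^sup>2 =
              2 * (\<alpha> - \<beta>)\<^sup>2 + 2 * ((b x)\<^sup>2 * (A x - B x)\<^sup>2)"
            unfolding power2_diff[of "\<alpha> - \<beta>" "b x * (A x - B x)"] power2_sum[of "\<alpha> - \<beta>" "b x * (A x - B x)"]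
              power_mult_distrib by simp
          moreover have "0 \<le> ((\<alpha> - \<beta>) + b x * (A x - B x))\<^sup>2"
            by (rule zero_le_power2)
          moreover have "(b x)\<^sup>2 * (A x - B x)\<^sup>2 \<le> L\<^sup>2 * (A x - B x)\<^sup>2"
            using elim l by (intro mult_right_mono power_mono) auto
          ultimately show "((\<alpha> - \<beta>) - b x * (A x - B x))\<^sup>2 \<le> 2 * (\<alpha> - \<beta>)\<^sup>2 + 2 * (L\<^sup>2 * (A x - B x)\<^sup>2)"
            by linarith
        qed simp
        finally show ?thesis
          using False by (simp add: distrib_left mult.assoc mult.left_commute)
      qed
    qed
  qed (use int in auto)
  also have "\<dots> = r\<^sup>2 * L\<^sup>2 * (q - p) + (2 * L\<^sup>2 * (\<alpha> - \<beta>)\<^sup>2 + 2 * L\<^sup>2 * L\<^sup>2 * (\<integral>x. (A x - B x)\<^sup>2 \<partial>U))"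
  proof -
    have "(\<integral>x. indicator {p<..<q} x \<partial>U) = q - p"
      using pq measure_U[of p q] by (simp add: Int_absorb2)
    moreover have "measure U {0<..<1} = 1"
      using measure_U[of 0 1] by simp
    ultimately show ?thesis
      using int by simp
  qed
  also have "\<dots> \<le> r\<^sup>2 * L\<^sup>2 * (2 * r) + (2 * L\<^sup>2 * (\<alpha> - \<beta>)\<^sup>2 + 2 * L\<^sup>2 * L\<^sup>2 * (\<integral>x. (A x - B x)\<^sup>2 \<partial>U))"
    using pq by (intro add_right_mono mult_left_mono) auto
  finally have "r\<^sup>2 * (L2_norm (\<lambda>x. a x - b x))\<^sup>2 \<le> r\<^sup>2 * L\<^sup>2 * (2 * r) +
      (2 * L\<^sup>2 * (\<alpha> - \<beta>)\<^sup>2 + 2 * L\<^sup>2 * L\<^sup>2 * (L2_norm (\<lambda>x. A x - B x))\<^sup>2)"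
    using int by (simp add: L2_norm_square)
  then show ?thesis
    by (simp add: algebra_simps power2_eq_square power3_eq_cube)
qed

text \<open>With t = E^(1/9) and r = t^4, both r^3 and the bound on \<delta>^2 are of order t^12.
  Dividing by r^2 = t^8 leaves N^2 of order t^4.\<close>

lemma optimise_split:
  fixes N E \<delta> L :: real
  assumes L: "0 < L" and nonneg: "0 \<le> N" "0 \<le> E" "0 \<le> \<delta>" and N: "N \<le> L"
    and \<delta>: "\<delta> ^ 3 \<le> L\<^sup>2 * E\<^sup>2"
    and split: "\<And>r. 0 < r \<Longrightarrow> r\<^sup>2 * N\<^sup>2 \<le> 2 * r ^ 3 * L\<^sup>2 + 2 * L\<^sup>2 * (\<delta>\<^sup>2 + L\<^sup>2 * E\<^sup>2)"
  shows "N \<le> sqrt (2 * L\<^sup>2 * (1 + (L powr (2 / 3))\<^sup>2 + L\<^sup>2)) * E powr (2 / 9)"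
proof -
  \<comment> \<open>K is the cube root of L^2, so the hypothesis on \<delta> becomes \<delta> <= K
    E^(2/3). The three summands in M stem from the r^3 term, from \<delta>^2 and from E^2.\<close>
  define K where "K = L powr (2 / 3)"
  define M where "M = 2 * L\<^sup>2 * (1 + K\<^sup>2 + L\<^sup>2)"
  have K: "0 \<le> K" "K ^ 3 = L\<^sup>2"
    using L by (auto simp: K_def powr_power)
  have M_ge: "L\<^sup>2 \<le> M"
    unfolding M_def using zero_le_mult_iff[of "L\<^sup>2" "K\<^sup>2"] zero_le_mult_iff[of "L\<^sup>2" "L\<^sup>2"]
    by (simp add: distrib_left)
  have "N \<le> sqrt M * E powr (2 / 9)"
  proof (cases "E = 0 \<or> 1 < E")
    case True
    then show ?thesis
    proof
      assume [simp]: "E = 0"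
      have "\<delta> = 0"
        using \<delta> nonneg(3) by (simp add: power_le_zero_eq)
      have "N = 0"
      proof (rule ccontr)
        assume "N \<noteq> 0"
        \<comment> \<open>For E = 0 the split reads N^2 <= 2 r L^2 for every r > 0; this r makes the
          right side half of N^2.\<close>
        define r where "r = N\<^sup>2 / (4 * L\<^sup>2)"
        have r: "0 < r" "4 * (r * L\<^sup>2) = N\<^sup>2"
          using \<open>N \<noteq> 0\<close> L by (auto simp: r_def)
        have "r\<^sup>2 * N\<^sup>2 \<le> r\<^sup>2 * (2 * (r * L\<^sup>2))"
          using split[OF r(1)] \<open>\<delta> = 0\<close> by (simp add: power2_eq_square power3_eq_cube mult_ac)
        then have "N\<^sup>2 \<le> 2 * (r * L\<^sup>2)"
          using r by simp
        then have "N\<^sup>2 \<le> 0"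
          using r by linarith
        then show False
          using \<open>N \<noteq> 0\<close> by simp
      qed
      then show ?thesis
        by simp
    next
      \<comment> \<open>For large E the trivial bound N <= L <= sqrt M is enough.\<close>
      assume E: "1 < E"
      have "N \<le> sqrt M * 1"
        using N L M_ge by (simp add: real_le_rsqrt order_trans)
      also have "\<dots> \<le> sqrt M * E powr (2 / 9)"
        using E order_trans[OF zero_le_power2 M_ge] by (intro mult_left_mono ge_one_powr_ge_zero) auto
      finally show ?thesis .
    qed
  next
    case False
    then have E: "0 < E" "E \<le> 1"
      using nonneg by auto
    \<comment> \<open>The ninth root turns all exponents into integers.\<close>
    define t where "t = E powr (1 / 9)"
    have t: "0 < t" "t \<le> 1" "E = t ^ 9" "E powr (2 / 9) = t\<^sup>2"
      using E by (auto simp: t_def powr_power powr_le1)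
    have "\<delta> ^ 3 \<le> (K * t ^ 6) ^ 3"
      using \<delta> K by (simp add: t(3) power_mult_distrib flip: power_mult)
    then have "\<delta> \<le> K * t ^ 6"
      using K t power_mono_iff[of \<delta> "K * t ^ 6" 3] nonneg by auto
    then have \<delta>2: "\<delta>\<^sup>2 \<le> K\<^sup>2 * t ^ 12"
      using power_mono[of \<delta> "K * t ^ 6" 2] nonneg by (simp add: power_mult_distrib flip: power_mult)
    \<comment> \<open>E^2 is t^18, and t <= 1 lets it be absorbed into the order t^12 of the other
      terms.\<close>
    have E2: "E\<^sup>2 \<le> t ^ 12"
      using power_decreasing[of 12 18 t] t by (simp flip: power_mult)
    have "t ^ 8 * N\<^sup>2 \<le> 2 * t ^ 12 * L\<^sup>2 + 2 * L\<^sup>2 * (\<delta>\<^sup>2 + L\<^sup>2 * E\<^sup>2)"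
      using split[of "t ^ 4"] t by (simp flip: power_mult)
    also have "\<dots> \<le> 2 * t ^ 12 * L\<^sup>2 + 2 * L\<^sup>2 * (K\<^sup>2 * t ^ 12 + L\<^sup>2 * t ^ 12)"
      using \<delta>2 E2 by (intro add_left_mono mult_left_mono add_mono) auto
    also have "\<dots> = t ^ 8 * (M * t ^ 4)"
      by (simp add: M_def algebra_simps flip: power_add)
    finally have "N\<^sup>2 \<le> M * t ^ 4"
      using t by simp
    then have "N \<le> sqrt (M * t ^ 4)"
      by (rule real_le_rsqrt)
    also have "\<dots> = sqrt M * sqrt ((t\<^sup>2)\<^sup>2)"
      by (simp add: real_sqrt_mult)
    also have "\<dots> = sqrt M * t\<^sup>2"
      by (subst real_sqrt_abs) simp
    finally show ?thesis
      by (simp add: t(4))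
  qed
  then show ?thesis
    by (simp add: M_def K_def)
qed

text \<open>The constant is explicit in L. Uniqueness is the case of zero distance, where
  \<open>0 powr (2 / 9) = 0\<close> makes the bound vanish.\<close>

lemma
  assumes l: "0 < l" and L: "0 < L" and a: "a \<in> coefficients l L" and b: "b \<in> coefficients l L"
    and u: "is_weak_solution a (\<lambda>x. 1) u" and v: "is_weak_solution b (\<lambda>x. 1) v"
  shows coefficient_stability: "L2_norm (\<lambda>x. a x - b x) \<le>
      sqrt (2 * L\<^sup>2 * (1 + (L powr (2 / 3))\<^sup>2 + L\<^sup>2)) * H10_norm (\<lambda>x. u x - v x) powr (2 / 9)" (is ?bound)
    and coefficient_unique: "AE x in U. u x = v x \<Longrightarrow> AE x in U. a x = b x"
proof -
  have H1: "u \<in> H1" "v \<in> H1"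
    using u v by (auto simp: is_weak_solution_def H10_def)
  note wd = H1[THEN weak_deriv_L2]
  note ab = coefficients_L2[OF a l] coefficients_L2[OF b l]
  note bounds = coefficientsD(2)[OF a] coefficientsD(2)[OF b]
  obtain \<alpha> where \<alpha>: "0 \<le> \<alpha>" "\<alpha> \<le> 1" "AE x in U. a x * weak_deriv u x = \<alpha> - x"
    using weak_solution_flux_unit[OF a l u] by blast
  obtain \<beta> where \<beta>: "0 \<le> \<beta>" "\<beta> \<le> 1" "AE x in U. b x * weak_deriv v x = \<beta> - x"
    using weak_solution_flux_unit[OF b l v] by blast
  define E where "E = L2_norm (\<lambda>x. weak_deriv u x - weak_deriv v x)"
  \<comment> \<open>The norm uses the derivative chosen for u - v, which agrees with the difference
    of the chosen derivatives only almost everywhere.\<close>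
  have E: "H10_norm (\<lambda>x. u x - v x) = E"
    unfolding H10_norm_def E_def
    by (intro L2_norm_cong_AE weak_deriv_L2 H1_diff H1 L2_diff wd weak_deriv_diff)
  have "L2_norm (\<lambda>x. a x - b x) \<le> L"
  proof -
    have "(\<integral>x. (a x - b x)\<^sup>2 \<partial>U) \<le> (\<integral>x. L\<^sup>2 \<partial>U)"
    proof (rule integral_mono_AE)
      show "AE x in U. (a x - b x)\<^sup>2 \<le> L\<^sup>2"
        using bounds
      proof eventually_elim
        case (elim x)
        then show ?case
          using l L by (intro abs_le_square_iff[THEN iffD1]) auto
      qed
    qed (use L2_integrable_square[OF L2_diff[OF ab]] in auto)
    then show ?thesis
      using L measure_U[of 0 1] by (simp add: L2_norm_def real_le_lsqrt)
  qed
  moreover have "\<bar>\<alpha> - \<beta>\<bar> ^ 3 \<le> L\<^sup>2 * E\<^sup>2"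
    unfolding E_def by (rule flux_constants_close[OF l wd bounds \<alpha>(3) \<beta>(3) \<alpha>(1,2) \<beta>(1,2)])
  moreover have "r\<^sup>2 * (L2_norm (\<lambda>x. a x - b x))\<^sup>2 \<le> 2 * r ^ 3 * L\<^sup>2 + 2 * L\<^sup>2 * (\<bar>\<alpha> - \<beta>\<bar>\<^sup>2 + L\<^sup>2 * E\<^sup>2)"
    if "0 < r" for r
    using coefficient_difference_split[OF l wd ab bounds \<alpha>(3) \<beta>(3) \<alpha>(1,2) that] by (simp add: E_def)
  ultimately show bound: ?bound
    unfolding E by (intro optimise_split[where \<delta> = "\<bar>\<alpha> - \<beta>\<bar>"] L L2_norm_nonneg) (auto simp: E_def L2_norm_nonneg)
  assume "AE x in U. u x = v x"
  then have "AE x in U. weak_deriv u x = weak_deriv v x"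
    by (rule is_weak_derivative_unique[OF H1[THEN H1_L2] _ wd(1) weak_deriv_is_weak_derivative[OF H1(1)]
          wd(2) weak_deriv_is_weak_derivative[OF H1(2)]])
  then have "E = 0"
    unfolding E_def by (subst L2_norm_eq_0_iff) (auto intro: L2_diff wd)
  then have "L2_norm (\<lambda>x. a x - b x) = 0"
    using bound L2_norm_nonneg[of "\<lambda>x. a x - b x"] by (simp add: E)
  then show "AE x in U. a x = b x"
    by (subst (asm) L2_norm_eq_0_iff) (auto intro: L2_diff ab)
qed

theorem theorem6p3:
  fixes l L :: real
  assumes "0 < l" and "0 < L"
  shows "(\<exists>C. \<forall>a\<in>coefficients l L. \<forall>b\<in>coefficients l L. \<forall>u\<^sub>a u\<^sub>b.
            is_weak_solution a (\<lambda>x. 1) u\<^sub>a \<longrightarrow> is_weak_solution b (\<lambda>x. 1) u\<^sub>b \<longrightarrow>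
            L2_norm (\<lambda>x. a x - b x) \<le> C * H10_norm (\<lambda>x. u\<^sub>a x - u\<^sub>b x) powr (2 / 9)) \<and>
         (\<forall>a\<in>coefficients l L. \<forall>b\<in>coefficients l L. \<forall>u\<^sub>a u\<^sub>b.
            is_weak_solution a (\<lambda>x. 1) u\<^sub>a \<longrightarrow> is_weak_solution b (\<lambda>x. 1) u\<^sub>b \<longrightarrow>
            (AE x in U. u\<^sub>a x = u\<^sub>b x) \<longrightarrow> (AE x in U. a x = b x))"
  by (intro conjI exI ballI allI impI)
    (rule coefficient_stability[OF assms], assumption+, rule coefficient_unique[OF assms], assumption+)

end
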